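(* Let $k\ge 1$ be an integer, let $g$ be a graph and let $S\subseteq V(g)$ be a $k$-defective clique. Let $\pi_1,\dots,\pi_c$ be the color classes of a proper coloring with $c$ colors of the subgraph of $g$ induced by $V(g)\setminus S$ (so $\pi_1,\dots,\pi_c$ partition $V(g)\setminus S$ into independent sets). For each $i$, order the vertices of $\pi_i$ as $v_{i_1},v_{i_2},\dots,v_{i_{|\pi_i|}}$ in non-decreasing order of $|\overline{N}_S(\cdot)|$, and define weights $$w(v_{i_j})=|\overline{N}_S(v_{i_j})|+j-1,\qquad 1\le j\le |\pi_i|.$$ Let $v_1,v_2,\dots,v_{|V(g)\setminus S|}$ be an ordering of $V(g)\setminus S$ in non-decreasing order of the weights $w(\cdot)$. Let $i^*$ be the largest integer $i$ with $0\le i\le |V(g)\setminus S|$ such that $$\sum_{j=1}^{i} w(v_j)\le k-|\overline{E}(S)|.$$ Then every $k$-defective clique $C$ with $S\subseteq C\subseteq V(g)$ satisfies $|C|\le |S|+i^*$.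
   Context: All graphs are finite, simple and undirected. For a vertex set $A\subseteq V(g)$, $\overline{E}(A)$ is the set of non-edges (unordered pairs of distinct non-adjacent vertices) of the subgraph of $g$ induced by $A$; $A$ is a $k$-defective clique if $|\overline{E}(A)|\le k$. $\overline{N}_S(u)$ denotes the set of vertices of $S$ that are different from $u$ and not adjacent to $u$ in $g$. *)

theory Defs
  imports "Graph_Theory.Pair_Digraph"
begin

text \<open>
  A finite simple undirected graph is a \<open>pair_graph\<close>: a finite loopless digraph whose arc
  relation is symmetric, so that \<open>u\<close> and \<open>v\<close> are adjacent iff \<open>(u, v) \<in> parcs G\<close>.
  Non-edges are nevertheless unordered pairs.
\<close>

definition nonedges :: "'a pair_pre_digraph \<Rightarrow> 'a set \<Rightarrow> 'a set set" where
  "nonedges G A = {{u, v} | u v. u \<in> A \<and> v \<in> A \<and> u \<noteq> v \<and> (u, v) \<notin> parcs G}"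

definition defective_clique :: "'a pair_pre_digraph \<Rightarrow> nat \<Rightarrow> 'a set \<Rightarrow> bool" where
  "defective_clique G k A \<longleftrightarrow> A \<subseteq> pverts G \<and> card (nonedges G A) \<le> k"

definition nonneighbors :: "'a pair_pre_digraph \<Rightarrow> 'a set \<Rightarrow> 'a \<Rightarrow> 'a set" where
  "nonneighbors G S u = {v \<in> S. v \<noteq> u \<and> (u, v) \<notin> parcs G}"

text \<open>Proper coloring, with colors \<open>1, \<dots>, c\<close>, of the subgraph induced by \<open>A\<close>;
  colors may be unused.\<close>

definition proper_coloring_on :: "'a pair_pre_digraph \<Rightarrow> 'a set \<Rightarrow> nat \<Rightarrow> ('a \<Rightarrow> nat) \<Rightarrow> bool" where
  "proper_coloring_on G A c col \<longleftrightarrow>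
     col ` A \<subseteq> {1..c} \<and> (\<forall>u\<in>A. \<forall>v\<in>A. (u, v) \<in> parcs G \<longrightarrow> col u \<noteq> col v)"

text \<open>\<open>x 1, \<dots>, x (card A)\<close> lists the finite set \<open>A\<close> without repetition, in
  non-decreasing order of \<open>f\<close>.\<close>

definition nondecreasing_ordering :: "('a \<Rightarrow> nat) \<Rightarrow> 'a set \<Rightarrow> (nat \<Rightarrow> 'a) \<Rightarrow> bool" where
  "nondecreasing_ordering f A x \<longleftrightarrow>
     bij_betw x {1..card A} A \<and> mono_on {1..card A} (\<lambda>j. f (x j))"

end

theory Submission
  imports Defs
begin

text \<open>
  Consider three disjoint kinds of non-edges of \<open>C\<close>: inside \<open>S\<close>, between \<open>S\<close> and \<open>C - S\<close>, and
  inside a color class of \<open>C - S\<close>.  If \<open>C\<close> contains \<open>d\<close> vertices of a class, the last two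
  kinds contribute at least as much as the weights of the first \<open>d\<close> vertices of that class,
  since \<open>0 + 1 + \<dots> + (d - 1)\<close> is the number of pairs among \<open>d\<close> vertices.  Altogether one gets
  \<open>card (C - S)\<close> distinct vertices whose total weight is at most \<open>k - card (nonedges G S)\<close>, and
  the \<open>card (C - S)\<close> lightest vertices weigh no more.
\<close>

text \<open>An exchange argument: with \<open>m = card I\<close>, as many indices lie in
  \<open>{1..m}\<close> but not in \<open>I\<close> as lie in \<open>I\<close> but not in
  \<open>{1..m}\<close>. Each of the former contributes at most \<open>g m\<close>, each of the
  latter exceeds \<open>m\<close> and contributes at least \<open>g m\<close>.\<close>

lemma sum_initial_segment_le:
  fixes g :: "nat \<Rightarrow> nat"
  assumes mono: "mono_on {1..n} g" and I: "I \<subseteq> {1..n}"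
  shows "(\<Sum>j=1..card I. g j) \<le> sum g I"
proof -
  define m where "m = card I"
  have fin: "finite I"
    using I finite_subset by blast
  have mn: "m \<le> n"
    unfolding m_def using card_mono[OF _ I] by simp
  have "card I = card {1..m}"
    by (simp add: m_def)
  then have card_eq: "card ({1..m} - I) = card (I - {1..m})"
    using fin by (simp add: card_Diff_subset_Int Int_commute)
  have "sum g ({1..m} - I) \<le> card ({1..m} - I) * g m"
    using sum_bounded_above[of "{1..m} - I" g "g m"] mn
    by (fastforce intro: mono_onD[OF mono])
  also have "\<dots> = card (I - {1..m}) * g m"
    by (simp only: card_eq)
  also have "\<dots> \<le> sum g (I - {1..m})"
  proof -
    have "g m \<le> g j" if "j \<in> I - {1..m}" for j
    proof -
      \<comment> \<open>Monotonicity is known only from index 1 on, so \<open>g m\<close> can be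
        compared with \<open>g j\<close> only for positive \<open>m\<close>.\<close>
      have "m \<noteq> 0"
        using that fin m_def by auto
      then show ?thesis
        using that I mn by (intro mono_onD[OF mono]) auto
    qed
    then show ?thesis
      using sum_bounded_below[of "I - {1..m}" "g m" g] by simp
  qed
  finally have "sum g ({1..m} - I) \<le> sum g (I - {1..m})" .
  moreover have "sum g {1..m} = sum g ({1..m} \<inter> I) + sum g ({1..m} - I)"
    by (rule sum.Int_Diff) simp
  moreover have "sum g I = sum g (I \<inter> {1..m}) + sum g (I - {1..m})"
    by (rule sum.Int_Diff) (rule fin)
  ultimately show ?thesis
    by (simp add: m_def Int_commute)
qed

text \<open>Pulling \<open>B\<close> back along the bijection \<open>x\<close> gives an index set of
  the same size, which reduces the claim to initial segments of indices. The main proof uses this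
  twice: inside a color class, ordered by non-neighbor counts, and globally, ordered by
  weight.\<close>

lemma nondecreasing_ordering_sum_le:
  assumes ord: "nondecreasing_ordering f A x" and "B \<subseteq> A"
  shows "(\<Sum>j=1..card B. f (x j)) \<le> sum f B"
proof -
  define I where "I = {j \<in> {1..card A}. x j \<in> B}"
  have bij: "bij_betw x {1..card A} A" and mono: "mono_on {1..card A} (\<lambda>j. f (x j))"
    using ord by (auto simp: nondecreasing_ordering_def)
  have "x ` I = x ` {1..card A} \<inter> B"
    unfolding I_def by blast
  also have "\<dots> = B"
    using bij \<open>B \<subseteq> A\<close> by (simp add: bij_betw_def Int_absorb1)
  finally have "x ` I = B" .
  moreover have "inj_on x I"
    using bij by (auto simp: I_def intro: inj_on_subset[OF bij_betw_imp_inj_on])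
  ultimately have "bij_betw x I B"
    by (simp add: bij_betw_def)
  then have "card I = card B" "(\<Sum>j\<in>I. f (x j)) = sum f B"
    by (auto intro: bij_betw_same_card sum.reindex_bij_betw)
  moreover have "(\<Sum>j=1..card I. f (x j)) \<le> (\<Sum>j\<in>I. f (x j))"
    by (rule sum_initial_segment_le[OF mono]) (auto simp: I_def)
  ultimately show ?thesis
    by simp
qed

lemma sum_pred_eq_choose_2: "(\<Sum>j=1..d. j - 1) = d choose 2"
  by (induction d) (auto simp: numeral_2_eq_2)

lemma finite_nonedges: "finite A \<Longrightarrow> finite (nonedges G A)"
  by (rule finite_subset[of _ "Pow A"]) (auto simp: nonedges_def)

text \<open>The three kinds of non-edges are told apart by the trace \<open>e - S\<close>: empty
  inside \<open>S\<close>, a single vertex of some \<open>D i\<close> for a non-edge between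
  \<open>D i\<close> and \<open>S\<close>, and a pair for a non-edge inside \<open>D i\<close>.
  Non-edges between different sets \<open>D i\<close> are left uncounted, hence only a lower
  bound.\<close>

lemma card_nonedges_ge:
  assumes fin: "finite C" and "S \<subseteq> C"
    and fin_I: "finite I"
    and D: "\<And>i. i \<in> I \<Longrightarrow> D i \<subseteq> C - S"
    and disj: "\<And>i j. i \<in> I \<Longrightarrow> j \<in> I \<Longrightarrow> i \<noteq> j \<Longrightarrow> D i \<inter> D j = {}"
    and indep: "\<And>i u v. i \<in> I \<Longrightarrow> u \<in> D i \<Longrightarrow> v \<in> D i \<Longrightarrow> (u, v) \<notin> parcs G"
  shows "card (nonedges G S)
      + (\<Sum>i\<in>I. (\<Sum>u\<in>D i. card (nonneighbors G S u)) + (card (D i) choose 2))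
    \<le> card (nonedges G C)"
proof -
  \<comment> \<open>\<open>F u\<close> collects the non-edges from \<open>u\<close> to
    \<open>S\<close>, and \<open>U i\<close> those from \<open>D i\<close> to \<open>S\<close>.
    \<open>P i\<close> consists of all pairs in \<open>D i\<close>, which are non-edges because
    \<open>D i\<close> is independent.\<close>
  define F where "F u = (\<lambda>s. {u, s}) ` nonneighbors G S u" for u
  define P where "P i = {e. e \<subseteq> D i \<and> card e = 2}" for i
  define U where "U i = (\<Union>u\<in>D i. F u)" for i
  have fin_S: "finite S"
    using fin \<open>S \<subseteq> C\<close> finite_subset by blast
  have fin_D: "finite (D i)" if "i \<in> I" for i
    using D[OF that] fin finite_subset by blast
  have fin_F: "finite (F u)" for u
    using fin_S by (simp add: F_def nonneighbors_def)
  have card_F: "card (F u) = card (nonneighbors G S u)" for u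
    unfolding F_def by (rule card_image) (auto simp: inj_on_def doubleton_eq_iff)
  have F_mem: "\<exists>s\<in>S. e = {u, s} \<and> s \<noteq> u \<and> (u, s) \<notin> parcs G" if "e \<in> F u" for e u
    using that by (auto simp: F_def nonneighbors_def)
  \<comment> \<open>The trace recovers the endpoint outside \<open>S\<close>, so the sets
    \<open>F u\<close> for different \<open>u\<close> are disjoint and their cardinalities add
    up.\<close>
  have F_trace: "e - S = {u}" if "e \<in> F u" "u \<notin> S" for e u
    using F_mem[OF that(1)] that(2) by auto
  have U_trace: "\<exists>u\<in>D i. e - S = {u} \<and> e \<inter> S \<noteq> {}" if i: "i \<in> I" "e \<in> U i" for e i
  proof -
    obtain u where "u \<in> D i" "e \<in> F u"
      using i(2) by (auto simp: U_def)
    moreover have "u \<notin> S"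
      using D[OF i(1)] \<open>u \<in> D i\<close> by auto
    ultimately show ?thesis
      using F_trace F_mem by blast
  qed
  have P_mem: "e \<subseteq> D i \<and> e \<noteq> {}" if "e \<in> P i" for e i
    using that by (auto simp: P_def)
  have fin_U: "finite (U i)" and fin_P: "finite (P i)" if "i \<in> I" for i
    using fin_D[OF that] fin_F by (auto simp: U_def P_def)
  have card_U: "card (U i) = (\<Sum>u\<in>D i. card (nonneighbors G S u))" if "i \<in> I" for i
  proof -
    have "F u \<inter> F u' = {}" if "u \<in> D i" "u' \<in> D i" "u \<noteq> u'" for u u'
    proof -
      have "u \<notin> S" "u' \<notin> S"
        using that D[OF \<open>i \<in> I\<close>] by auto
      then show ?thesis
        using F_trace[of _ u] F_trace[of _ u'] \<open>u \<noteq> u'\<close> by blast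
    qed
    then show ?thesis
      unfolding U_def using fin_D[OF that] fin_F card_F by (simp add: card_UN_disjoint)
  qed
  have card_P: "card (P i) = card (D i) choose 2" if "i \<in> I" for i
    unfolding P_def by (rule n_subsets[OF fin_D[OF that]])
  \<comment> \<open>Members of \<open>U i\<close> meet \<open>S\<close>, whereas members of
    \<open>P i\<close> avoid it.\<close>
  have UP: "U i \<inter> P i = {}" if "i \<in> I" for i
    using U_trace[OF that] P_mem D[OF that] by blast
  \<comment> \<open>Both halves are needed later: a trace inside \<open>D i\<close> separates
    different indices, and a nonempty trace separates these non-edges from those inside
    \<open>S\<close>.\<close>
  have UP_trace: "e - S \<noteq> {} \<and> e - S \<subseteq> D i" if "i \<in> I" "e \<in> U i \<union> P i" for e i
    using that(2)
  proof
    assume "e \<in> U i"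
    from U_trace[OF that(1) this] obtain u where "u \<in> D i" "e - S = {u}"
      by blast
    then show ?thesis
      by simp
  next
    assume "e \<in> P i"
    then have "e \<subseteq> D i" "e \<noteq> {}"
      using P_mem by auto
    moreover have "D i \<inter> S = {}"
      using D[OF that(1)] by auto
    ultimately show ?thesis
      by auto
  qed
  have UP_disj: "(U i \<union> P i) \<inter> (U j \<union> P j) = {}" if "i \<in> I" "j \<in> I" "i \<noteq> j" for i j
    using UP_trace[OF that(1)] UP_trace[OF that(2)] disj[OF that] by blast
  have S_disj: "nonedges G S \<inter> (\<Union>i\<in>I. U i \<union> P i) = {}"
  proof -
    have "e \<subseteq> S" if "e \<in> nonedges G S" for e
      using that by (auto simp: nonedges_def)
    then show ?thesis
      using UP_trace by blast
  qed
  have sub: "nonedges G S \<union> (\<Union>i\<in>I. U i \<union> P i) \<subseteq> nonedges G C"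
  proof (intro Un_least UN_least)
    show "nonedges G S \<subseteq> nonedges G C"
      using \<open>S \<subseteq> C\<close> by (fastforce simp: nonedges_def)
  next
    fix i assume i: "i \<in> I"
    show "U i \<subseteq> nonedges G C"
    proof
      fix e assume "e \<in> U i"
      then obtain u where u: "u \<in> D i" "e \<in> F u"
        by (auto simp: U_def)
      with F_mem obtain s where "s \<in> S" "e = {u, s}" "s \<noteq> u" "(u, s) \<notin> parcs G"
        by blast
      then show "e \<in> nonedges G C"
        using D[OF i] u \<open>S \<subseteq> C\<close> unfolding nonedges_def by blast
    qed
    show "P i \<subseteq> nonedges G C"
    proof
      fix e assume e: "e \<in> P i"
      then obtain u s where "e = {u, s}" "u \<noteq> s"
        by (auto simp: P_def card_2_iff)
      moreover have "u \<in> D i" "s \<in> D i"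
        using e calculation by (auto simp: P_def)
      ultimately show "e \<in> nonedges G C"
        using D[OF i] indep[OF i] unfolding nonedges_def by blast
    qed
  qed
  have "card (\<Union>i\<in>I. U i \<union> P i) = (\<Sum>i\<in>I. card (U i \<union> P i))"
    using fin_I fin_U fin_P UP_disj by (intro card_UN_disjoint) auto
  also have "\<dots> = (\<Sum>i\<in>I. (\<Sum>u\<in>D i. card (nonneighbors G S u)) + (card (D i) choose 2))"
    using fin_U fin_P UP by (intro sum.cong) (auto simp: card_Un_disjoint card_U card_P)
  finally have "card (nonedges G S)
      + (\<Sum>i\<in>I. (\<Sum>u\<in>D i. card (nonneighbors G S u)) + (card (D i) choose 2))
    = card (nonedges G S \<union> (\<Union>i\<in>I. U i \<union> P i))"
    using fin_S fin_I fin_U fin_P S_disj by (subst card_Un_disjoint) (auto simp: finite_nonedges)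
  also have "\<dots> \<le> card (nonedges G C)"
    by (rule card_mono[OF finite_nonedges[OF fin] sub])
  finally show ?thesis .
qed

theorem mainTheorem2:
  fixes G :: "'a pair_pre_digraph"
    and k c istar :: nat
    and S C :: "'a set"
    and col :: "'a \<Rightarrow> nat"
    and \<pi> :: "nat \<Rightarrow> 'a set"
    and vc :: "nat \<Rightarrow> nat \<Rightarrow> 'a"
    and w :: "'a \<Rightarrow> nat"
    and v :: "nat \<Rightarrow> 'a"
  assumes "k \<ge> 1"
    and "pair_graph G"
    and "defective_clique G k S"
    and "proper_coloring_on G (pverts G - S) c col"
    and "\<And>i. i \<in> {1..c} \<Longrightarrow> \<pi> i = {u \<in> pverts G - S. col u = i}"
    and "\<And>i. i \<in> {1..c} \<Longrightarrow>
           nondecreasing_ordering (\<lambda>u. card (nonneighbors G S u)) (\<pi> i) (vc i)"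
    and "\<And>i j. i \<in> {1..c} \<Longrightarrow> j \<in> {1..card (\<pi> i)} \<Longrightarrow>
           w (vc i j) = card (nonneighbors G S (vc i j)) + (j - 1)"
    and "nondecreasing_ordering w (pverts G - S) v"
    and "istar = Max {i \<in> {0..card (pverts G - S)}.
           int (\<Sum>j=1..i. w (v j)) \<le> int k - int (card (nonedges G S))}"
    and "defective_clique G k C"
    and "S \<subseteq> C"
  shows "card C \<le> card S + istar"
proof -
  define R where "R = pverts G - S"
  define D where "D i = C \<inter> \<pi> i" for i
  \<comment> \<open>A vertex of \<open>D i\<close> may stand late in its class and weigh more than
    the non-edges it accounts for. It is therefore traded for the first \<open>card (D i)\<close>
    vertices of the class, whose positions are exactly \<open>1, ..., card (D i)\<close>.\<close>
  define T where "T i = vc i ` {1..card (D i)}" for i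
  note \<pi>_eq = assms(5)[folded R_def]
  interpret pair_graph G by fact
  have fin_R: "finite R"
    by (simp add: R_def)
  have C: "C \<subseteq> pverts G" "card (nonedges G C) \<le> k"
    using \<open>defective_clique G k C\<close> by (auto simp: defective_clique_def)
  have fin_C: "finite C"
    using C(1) by (rule finite_subset) simp
  have fin_\<pi>: "finite (\<pi> i)" if "i \<in> {1..c}" for i
    using fin_R by (simp add: \<pi>_eq[OF that])
  have col: "col u \<in> {1..c}" if "u \<in> R" for u
    using assms(4) that by (auto simp: proper_coloring_on_def R_def)
  have indep: "(u, u') \<notin> parcs G" if "i \<in> {1..c}" "u \<in> \<pi> i" "u' \<in> \<pi> i" for i u u'
  proof -
    have "u \<in> R" "u' \<in> R" "col u = col u'"
      using that(2,3) by (simp_all add: \<pi>_eq[OF that(1)])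
    then show ?thesis
      using assms(4) unfolding proper_coloring_on_def R_def by blast
  qed
  have \<pi>_disj: "\<pi> i \<inter> \<pi> j = {}" if "i \<in> {1..c}" "j \<in> {1..c}" "i \<noteq> j" for i j
    using \<pi>_eq that by auto
  have D_sub: "D i \<subseteq> C - S" if "i \<in> {1..c}" for i
    using \<pi>_eq[OF that] by (auto simp: D_def R_def)
  have D_disj: "D i \<inter> D j = {}" if "i \<in> {1..c}" "j \<in> {1..c}" "i \<noteq> j" for i j
    using \<pi>_disj[OF that] by (auto simp: D_def)
  have D_Un: "(\<Union>i\<in>{1..c}. D i) = C - S"
  proof
    show "C - S \<subseteq> (\<Union>i\<in>{1..c}. D i)"
    proof
      fix u assume u: "u \<in> C - S"
      then have "u \<in> R"
        using C by (auto simp: R_def)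
      then show "u \<in> (\<Union>i\<in>{1..c}. D i)"
        using u col[of u] \<pi>_eq[of "col u"] by (auto simp: D_def)
    qed
  qed (use D_sub in blast)
  have D_le: "card (D i) \<le> card (\<pi> i)" if "i \<in> {1..c}" for i
    using fin_\<pi>[OF that] by (simp add: D_def card_mono)
  have vc_bij: "bij_betw (vc i) {1..card (\<pi> i)} (\<pi> i)" if "i \<in> {1..c}" for i
    using assms(6)[OF that] by (simp add: nondecreasing_ordering_def)
  have vc_inj: "inj_on (vc i) {1..card (D i)}" if "i \<in> {1..c}" for i
    by (rule inj_on_subset[OF bij_betw_imp_inj_on[OF vc_bij[OF that]]]) (use D_le[OF that] in auto)
  have card_T: "card (T i) = card (D i)" if "i \<in> {1..c}" for i
    using card_image[OF vc_inj[OF that]] by (simp add: T_def)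
  have T_sub: "T i \<subseteq> \<pi> i" if "i \<in> {1..c}" for i
  proof -
    have "T i \<subseteq> vc i ` {1..card (\<pi> i)}"
      unfolding T_def using D_le[OF that] by (intro image_mono) auto
    then show ?thesis
      using vc_bij[OF that] by (simp add: bij_betw_def)
  qed
  have T_disj: "T i \<inter> T j = {}" if "i \<in> {1..c}" "j \<in> {1..c}" "i \<noteq> j" for i j
    using \<pi>_disj[OF that] T_sub that by blast
  have sum_T: "sum w (T i) \<le> (\<Sum>u\<in>D i. card (nonneighbors G S u)) + (card (D i) choose 2)"
    if i: "i \<in> {1..c}" for i
  proof -
    have "sum w (T i) = (\<Sum>j=1..card (D i). w (vc i j))"
      unfolding T_def by (simp only: sum.reindex[OF vc_inj[OF i]] o_def)
    also have "\<dots> = (\<Sum>j=1..card (D i). card (nonneighbors G S (vc i j)) + (j - 1))"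
      using D_le[OF i] assms(7)[OF i] by (intro sum.cong) auto
    also have "\<dots> = (\<Sum>j=1..card (D i). card (nonneighbors G S (vc i j))) + (card (D i) choose 2)"
      by (simp only: sum.distrib sum_pred_eq_choose_2)
    \<comment> \<open>The first vertices of the class have the smallest non-neighbor counts among
      all choices of \<open>card (D i)\<close> of its vertices.\<close>
    also have "\<dots> \<le> (\<Sum>u\<in>D i. card (nonneighbors G S u)) + (card (D i) choose 2)"
      using nondecreasing_ordering_sum_le[OF assms(6)[OF i], of "D i"] by (simp add: D_def)
    finally show ?thesis .
  qed
  have card_Un_T: "card (\<Union>i\<in>{1..c}. T i) = card (C - S)"
  proof -
    have "card (\<Union>i\<in>{1..c}. T i) = (\<Sum>i\<in>{1..c}. card (T i))"
      using T_disj by (intro card_UN_disjoint) (auto simp: T_def)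
    also have "\<dots> = (\<Sum>i\<in>{1..c}. card (D i))"
      by (intro sum.cong) (auto simp: card_T)
    also have "\<dots> = card (\<Union>i\<in>{1..c}. D i)"
      using D_disj fin_C by (intro card_UN_disjoint[symmetric]) (auto simp: D_def)
    finally show ?thesis
      by (simp only: D_Un)
  qed
  have "(\<Union>i\<in>{1..c}. T i) \<subseteq> R"
    using T_sub \<pi>_eq by blast
  \<comment> \<open>The union of the \<open>T i\<close> has as many vertices as
    \<open>C - S\<close>, so it weighs at least as much as the equally many lightest
    vertices.\<close>
  from nondecreasing_ordering_sum_le[OF assms(8)[folded R_def] this]
  have "(\<Sum>j=1..card (C - S). w (v j)) \<le> sum w (\<Union>i\<in>{1..c}. T i)"
    by (simp only: card_Un_T)
  also have "\<dots> = (\<Sum>i\<in>{1..c}. sum w (T i))"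
    using T_disj by (intro sum.UNION_disjoint) (auto simp: T_def)
  also have "\<dots> \<le> (\<Sum>i\<in>{1..c}. (\<Sum>u\<in>D i. card (nonneighbors G S u)) + (card (D i) choose 2))"
    by (rule sum_mono) (rule sum_T)
  finally have "card (nonedges G S) + (\<Sum>j=1..card (C - S). w (v j)) \<le> k"
    (is "?e + ?W \<le> k")
    using card_nonedges_ge[of C S "{1..c}" D G] fin_C \<open>S \<subseteq> C\<close> D_sub D_disj indep C(2)
    by (fastforce simp: D_def)
  then have "int ?W \<le> int k - int ?e"
    by linarith
  moreover have "card (C - S) \<le> card (pverts G - S)"
    using C(1) by (intro card_mono) auto
  \<comment> \<open>\<open>card (C - S)\<close> itself satisfies the two conditions on
    \<open>i\<close> in the finite set whose maximum is \<open>istar\<close>.\<close>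
  ultimately have "card (C - S) \<le> istar"
    unfolding assms(9) by (intro Max_ge) simp_all
  moreover have "card (C - S) = card C - card S"
    using \<open>S \<subseteq> C\<close> fin_C by (intro card_Diff_subset) (auto intro: finite_subset)
  ultimately show ?thesis
    by simp
qed

end
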